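(* Let $s,t \geq 1$ be integers and let $\beta_{s,t}$ be the type-$\beta$ comb with $s$ teeth of length $t$. Then exactly one linear extension of $\beta_{s,t}$ avoids both patterns $213$ and $231$.
   Context: A linear extension of a finite poset $P$ on a set of integers is a listing $v=[v_1,\dots,v_n]$ of all elements of $P$, each exactly once, such that whenever $a \leq_P b$, $a$ appears before $b$. For $w \in S_3$, a sequence $v$ of distinct integers contains $w$ if there are indices $i<j<k$ with $(v_i,v_j,v_k)$ in the same relative order as $(w_1,w_2,w_3)$; otherwise $v$ avoids $w$. The type-$\beta$ comb $\beta_{s,t}$ is the poset on $\{1,\dots,st\}$ whose order is generated by the relations $ct+1 \leq (c+1)t+1$ for $0 \leq c \leq s-2$ (the spine) and $ct+j \leq ct+j+1$ for $0 \leq c \leq s-1$, $1 \leq j \leq t-1$ (the teeth $\{ct+1,\dots,ct+t\}$). *)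

theory Defs
  imports Main
begin

text \<open>Orders are given by their graph, a reflexive relation on the carrier \<open>A\<close>. Hence ``appears
  before'' is the weak comparison of positions; for distinct entries it is strict, since the
  listing has no repetitions.\<close>

definition linear_extension :: "'a set \<Rightarrow> 'a rel \<Rightarrow> 'a list \<Rightarrow> bool" where
  "linear_extension A r v \<longleftrightarrow>
     distinct v \<and> set v = A \<and>
     (\<forall>i < length v. \<forall>j < length v. (v ! i, v ! j) \<in> r \<longrightarrow> i \<le> j)"

definition same_relative_order :: "'a::linorder list \<Rightarrow> 'b::linorder list \<Rightarrow> bool" where
  "same_relative_order u w \<longleftrightarrow>
     length u = length w \<and>
     (\<forall>p < length w. \<forall>q < length w. u ! p < u ! q \<longleftrightarrow> w ! p < w ! q)"

text \<open>The pattern \<open>w\<close> is a permutation of \<open>{1, 2, 3}\<close> in one-line notation.\<close>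

definition contains_pattern :: "'a::linorder list \<Rightarrow> nat list \<Rightarrow> bool" where
  "contains_pattern v w \<longleftrightarrow>
     (\<exists>i j k. i < j \<and> j < k \<and> k < length v \<and> same_relative_order [v ! i, v ! j, v ! k] w)"

abbreviation avoids_pattern :: "'a::linorder list \<Rightarrow> nat list \<Rightarrow> bool" where
  "avoids_pattern v w \<equiv> \<not> contains_pattern v w"

definition comb_carrier :: "nat \<Rightarrow> nat \<Rightarrow> nat set" where
  "comb_carrier s t = {1..s * t}"

definition beta_spine :: "nat \<Rightarrow> nat \<Rightarrow> nat rel" where
  "beta_spine s t = {(c * t + 1, (c + 1) * t + 1) | c. c + 2 \<le> s}"

definition beta_teeth :: "nat \<Rightarrow> nat \<Rightarrow> nat rel" where
  "beta_teeth s t = {(c * t + j, c * t + j + 1) | c j. c + 1 \<le> s \<and> 1 \<le> j \<and> j + 1 \<le> t}"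

definition beta_order :: "nat \<Rightarrow> nat \<Rightarrow> nat rel" where
  "beta_order s t = Id_on (comb_carrier s t) \<union> (beta_spine s t \<union> beta_teeth s t)\<^sup>+"

lemma beta_generators:
  assumes "t \<ge> 1" "(a, b) \<in> beta_spine s t \<union> beta_teeth s t"
  shows "a \<in> comb_carrier s t" "b \<in> comb_carrier s t" "a < b"
proof -
  have "1 \<le> a \<and> a < b \<and> b \<le> s * t"
    using assms(2)
  proof
    assume "(a, b) \<in> beta_spine s t"
    then obtain c where c: "a = c * t + 1" "b = (c + 1) * t + 1" "c + 2 \<le> s"
      by (auto simp: beta_spine_def)
    have "(c + 2) * t \<le> s * t" using c(3) by (rule mult_le_mono1)
    then show ?thesis using c assms(1) by (simp add: algebra_simps)
  next
    assume "(a, b) \<in> beta_teeth s t"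
    then obtain c j where c: "a = c * t + j" "b = c * t + j + 1" "c + 1 \<le> s" "1 \<le> j" "j + 1 \<le> t"
      by (auto simp: beta_teeth_def)
    have "(c + 1) * t \<le> s * t" using c(3) by (rule mult_le_mono1)
    then show ?thesis using c by (simp add: algebra_simps)
  qed
  then show "a \<in> comb_carrier s t" "b \<in> comb_carrier s t" "a < b"
    by (auto simp: comb_carrier_def)
qed

lemma beta_order_partial_order:
  assumes "t \<ge> 1"
  shows "partial_order_on (comb_carrier s t) (beta_order s t)"
proof -
  let ?G = "beta_spine s t \<union> beta_teeth s t"
  have less: "a < b" if "(a, b) \<in> ?G\<^sup>+" for a b
    using that by (induction) (use beta_generators(3)[OF assms] less_trans in blast)+
  have "?G \<subseteq> comb_carrier s t \<times> comb_carrier s t"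
    using beta_generators(1,2)[OF assms, of _ _ s] by fast
  then have sub: "?G\<^sup>+ \<subseteq> comb_carrier s t \<times> comb_carrier s t"
    by (rule trancl_subset_Sigma)
  have "antisym (beta_order s t)"
    by (rule antisymI) (auto simp: beta_order_def dest!: less)
  moreover have "trans (beta_order s t)"
    by (rule transI) (auto simp: beta_order_def intro: trancl_trans)
  moreover have "refl_on (comb_carrier s t) (beta_order s t)"
    by (auto simp: beta_order_def refl_on_def)
  moreover have "beta_order s t \<subseteq> comb_carrier s t \<times> comb_carrier s t"
    using sub by (auto simp: beta_order_def)
  ultimately show ?thesis
    by (simp add: partial_order_on_def preorder_on_def)
qed

end

theory Submission
  imports Defs
begin

text \<open>The increasing listing is a linear extension without descents, so it avoids both patterns.
  Conversely let \<open>v\<close> avoid both, and let \<open>n = s * t\<close>. If \<open>v\<^sub>i > v\<^sub>j\<close> with \<open>i < j\<close>, then \<open>n\<close> cannot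
  come after \<open>v\<^sub>i\<close>, since \<open>v\<^sub>i\<close>, \<open>v\<^sub>j\<close>, \<open>n\<close> would form one of the patterns. But \<open>n - 1\<close> precedes \<open>n\<close>
  in the comb (along the last tooth, or along the spine if \<open>t = 1\<close>), so \<open>n - 1\<close>, \<open>n\<close>, \<open>v\<^sub>j\<close> is an
  occurrence of 231. Hence \<open>v\<close> is increasing.\<close>

text \<open>Both patterns start with their middle value, so comparing the other two entries with it
  fixes all relative orders.\<close>

lemma same_relative_order_213_iff:
  "same_relative_order [a, b, c] [2, 1, 3 :: nat] \<longleftrightarrow> b < a \<and> a < c"
  by (auto simp: same_relative_order_def less_Suc_eq numeral_3_eq_3 nth_Cons')

lemma same_relative_order_231_iff:
  "same_relative_order [a, b, c] [2, 3, 1 :: nat] \<longleftrightarrow> c < a \<and> a < b"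
  by (auto simp: same_relative_order_def less_Suc_eq numeral_3_eq_3 nth_Cons')

lemma contains_213_iff:
  "contains_pattern v [2, 1, 3] \<longleftrightarrow>
     (\<exists>i j k. i < j \<and> j < k \<and> k < length v \<and> v ! j < v ! i \<and> v ! i < v ! k)"
  by (simp only: contains_pattern_def same_relative_order_213_iff)

lemma contains_231_iff:
  "contains_pattern v [2, 3, 1] \<longleftrightarrow>
     (\<exists>i j k. i < j \<and> j < k \<and> k < length v \<and> v ! k < v ! i \<and> v ! i < v ! j)"
  by (simp only: contains_pattern_def same_relative_order_231_iff)

lemma sorted_avoids_213_231:
  assumes "sorted v"
  shows "avoids_pattern v [2, 1, 3]" "avoids_pattern v [2, 3, 1]"
proof -
  have "\<not> v ! j < v ! i" if "i < j" "j < length v" for i j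
    using assms that by (simp add: sorted_iff_nth_mono_less not_less)
  then show "avoids_pattern v [2, 1, 3]" "avoids_pattern v [2, 3, 1]"
    unfolding contains_213_iff contains_231_iff by (meson less_trans)+
qed

text \<open>Free of the comb: \<open>p\<close> and \<open>q\<close> are the positions of the largest
  and second largest entries.\<close>

lemma sorted_if_top_two_in_order:
  fixes v :: "'a::linorder list"
  assumes avoids: "avoids_pattern v [2, 1, 3]" "avoids_pattern v [2, 3, 1]"
    and pos: "q < p" "p < length v"
    and top: "\<And>i. i < length v \<Longrightarrow> i \<noteq> p \<Longrightarrow> i \<noteq> q \<Longrightarrow> v ! i < v ! q" "v ! q < v ! p"
  shows "sorted v"
  unfolding sorted_iff_nth_mono_less
proof (intro allI impI, rule ccontr)
  fix i j assume ij: "i < j" "j < length v" and "\<not> v ! i \<le> v ! j"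
  then have desc: "v ! j < v ! i" by simp
  have max: "v ! k < v ! p" if "k < length v" "k \<noteq> p" for k
    using top that by (metis less_trans)
  have "j \<noteq> p" using max[of i] ij desc by force
  have "p \<le> i"
  proof (rule ccontr)
    assume "\<not> p \<le> i"
    then have "i < p" "v ! i < v ! p" using max[of i] ij by auto
    \<comment> \<open>The maximum completes the descent: \<open>i\<close>, \<open>j\<close>,
      \<open>p\<close> is a 213 if \<open>j < p\<close>, and \<open>i\<close>, \<open>p\<close>,
      \<open>j\<close> is a 231 if \<open>p < j\<close>.\<close>
    with \<open>j \<noteq> p\<close> consider "j < p" | "p < j" by linarith
    then show False
      using avoids \<open>i < p\<close> \<open>v ! i < v ! p\<close> ij desc pos(2)
      unfolding contains_213_iff contains_231_iff by cases blast+
  qed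
  \<comment> \<open>Since \<open>q < p \<le> i < j\<close>, both top entries precede
    \<open>j\<close>, also when \<open>i = p\<close>.\<close>
  then have "p < j" "v ! j < v ! q" using top(1)[of j] ij pos by auto
  then show False
    using avoids(2) top(2) pos(1) ij(2) unfolding contains_231_iff by blast
qed

lemma beta_order_imp_le:
  assumes "t \<ge> 1" "(a, b) \<in> beta_order s t"
  shows "a \<le> b"
proof -
  have "a < b" if "(a, b) \<in> (beta_spine s t \<union> beta_teeth s t)\<^sup>+"
    using that by (induction) (use beta_generators(3)[OF assms(1)] less_trans in blast)+
  then show ?thesis using assms(2) by (auto simp: beta_order_def)
qed

lemma beta_order_top_two:
  assumes "t \<ge> 1" "s * t \<ge> 2"
  shows "(s * t - 1, s * t) \<in> beta_order s t"
proof -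
  have "(s * t - 1, s * t) \<in> beta_spine s t \<union> beta_teeth s t"
  proof (cases "t = 1")
    \<comment> \<open>The comb is a bare spine; its last relation has \<open>c = s - 2\<close>,
      where \<open>s \<ge> 2\<close> since \<open>s * t \<ge> 2\<close>.\<close>
    case True
    then have "s * t - 1 = (s - 2) * t + 1" "s * t = (s - 2 + 1) * t + 1" "s - 2 + 2 \<le> s"
      using assms(2) by auto
    then show ?thesis unfolding beta_spine_def by blast
  next
    case False
    then have "t \<ge> 2" using assms(1) by simp
    \<comment> \<open>The last relation of the last tooth: \<open>c = r\<close> and
      \<open>j = t - 1\<close>.\<close>
    from assms(2) obtain r where r: "s = r + 1" by (cases s) auto
    have "s * t - 1 = r * t + (t - 1)" "s * t = r * t + (t - 1) + 1"
      "r + 1 \<le> s" "1 \<le> t - 1" "t - 1 + 1 \<le> t"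
      using \<open>t \<ge> 2\<close> r by auto
    then show ?thesis unfolding beta_teeth_def by blast
  qed
  then show ?thesis by (auto simp: beta_order_def)
qed

theorem theorem17:
  fixes s t :: nat
  assumes "s \<ge> 1" and "t \<ge> 1"
  shows "\<exists>!v. linear_extension (comb_carrier s t) (beta_order s t) v \<and>
              avoids_pattern v [2, 1, 3] \<and> avoids_pattern v [2, 3, 1]"
proof (rule ex1I)
  let ?n = "s * t"
  let ?w = "[1..<Suc ?n]"
  \<comment> \<open>Index \<open>i\<close> holds \<open>i + 1\<close>, so comparing labels is
    comparing positions.\<close>
  have "linear_extension (comb_carrier s t) (beta_order s t) ?w"
    using beta_order_imp_le[OF assms(2)]
    by (fastforce simp: linear_extension_def comb_carrier_def simp del: upt_Suc)
  then show "linear_extension (comb_carrier s t) (beta_order s t) ?w \<and>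
      avoids_pattern ?w [2, 1, 3] \<and> avoids_pattern ?w [2, 3, 1]"
    using sorted_avoids_213_231[OF sorted_upt] by blast
  fix v
  assume v: "linear_extension (comb_carrier s t) (beta_order s t) v \<and>
      avoids_pattern v [2, 1, 3] \<and> avoids_pattern v [2, 3, 1]"
  then have dist: "distinct v" and set_v: "set v = {1..?n}"
    and before: "\<And>i j. i < length v \<Longrightarrow> j < length v \<Longrightarrow> (v ! i, v ! j) \<in> beta_order s t \<Longrightarrow> i \<le> j"
    by (auto simp: linear_extension_def comb_carrier_def)
  have len: "length v = ?n" using distinct_card[OF dist] set_v by simp
  have "sorted v"
  proof (cases "?n \<ge> 2")
    \<comment> \<open>There is at most one entry, and \<open>?n - 1\<close> is not in the
      carrier.\<close>
    case False
    then show ?thesis using len by (simp add: sorted_iff_nth_mono_less)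
  next
    case True
    then have "?n \<in> set v" "?n - 1 \<in> set v"
      unfolding set_v atLeastAtMost_iff by (safe; linarith)+
    then obtain p q where p: "p < length v" "v ! p = ?n" and q: "q < length v" "v ! q = ?n - 1"
      by (metis in_set_conv_nth)
    \<comment> \<open>The extension property is weak; strictness comes from the distinct
      values.\<close>
    have "q \<le> p" using before[OF q(1) p(1)] beta_order_top_two[OF assms(2) True] p(2) q(2) by simp
    moreover have "q \<noteq> p" using p(2) q(2) True by auto
    ultimately have "q < p" by simp
    moreover have "v ! i < v ! q" if "i < length v" "i \<noteq> p" "i \<noteq> q" for i
    proof -
      have "v ! i \<le> ?n" using nth_mem[OF that(1)] set_v by simp
      moreover have "v ! i \<noteq> v ! p" "v ! i \<noteq> v ! q"
        using that p(1) q(1) dist by (auto simp: nth_eq_iff_index_eq)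
      ultimately show ?thesis using p(2) q(2) by linarith
    qed
    moreover have "v ! q < v ! p" using p(2) q(2) True by simp
    ultimately show ?thesis using sorted_if_top_two_in_order v p(1) by blast
  qed
  moreover have "set v = set ?w"
    by (simp only: set_v set_upt atLeastLessThanSuc_atLeastAtMost)
  ultimately show "v = ?w"
    by (rule sorted_distinct_set_unique[OF _ dist sorted_upt distinct_upt])
qed

end
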